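(* Let $G\in\mathbb{GS}$ and let $r,s$ be nonnegative real numbers. Let $m(G)=\max\{|t|:\emptyset^t\text{ is an atom occurring in }G\}$ and define the $(r,s)$-adjoint $G^\circ_{r,s}=\overleftrightarrow{G}+\langle\emptyset^{-m(G)-r-1}\mid\emptyset^{m(G)+s+1}\rangle$. Then $Ls(G+G^\circ_{r,s})<-r$ and $Rs(G+G^\circ_{r,s})>s$.
   Context: A scoring game is written $G=\langle G^{\mathcal L}\mid G^{\mathcal R}\rangle$, where each of $G^{\mathcal L}$ (Left options) and $G^{\mathcal R}$ (Right options) is either a finite nonempty set of scoring games or an atom $\emptyset^{s}$, $s\in\mathbb R$ (the player to move on that side cannot move and the game ends with score $s$); game trees are finite. An atom occurring in $G$ is an atom of $G$ or of any follower of $G$. $G$ is guaranteed if for every follower $K$ of $G$: if $K^{\mathcal L}=\emptyset^\ell$ then $\ell\le s$ for every atom $\emptyset^s$ occurring in $K$, and if $K^{\mathcal R}=\emptyset^r$ then $s\le r$ for every atom $\emptyset^s$ occurring in $K$; $\mathbb{GS}$ is the class of guaranteed games. Disjunctive sum $G+H$: Left options are $G^L+H$ and $G+H^L$, except if both are left-atomic with atoms $\emptyset^{\ell_1},\emptyset^{\ell_2}$, then $(G+H)^{\mathcal L}=\emptyset^{\ell_1+\ell_2}$; Right symmetric. Stops: $Ls(G)=\ell$ if $G^{\mathcal L}=\emptyset^\ell$, otherwise $\max_{G^L}Rs(G^L)$; $Rs(G)=r$ if $G^{\mathcal R}=\emptyset^r$, otherwise $\min_{G^R}Ls(G^R)$.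 Conjugate: $\overleftrightarrow{G}=\langle\overleftrightarrow{G^{\mathcal R}}\mid\overleftrightarrow{G^{\mathcal L}}\rangle$, conjugating each option, with an atom $\emptyset^s$ becoming $\emptyset^{-s}$. *)

theory Defs
  imports Complex_Main "HOL-Library.FSet"
begin

datatype 'g side = Atom real | Opts (opts: "'g fset")
  where "opts (Atom s) = {||}"

text \<open>The datatype also contains games with an empty set of options on some side; these are
  not scoring games and are excluded by \<open>scoring_game\<close> below.\<close>

datatype game = Game (left: "game side") (right: "game side")

text \<open>\<open>follower G K\<close>: \<open>K\<close> is a follower of \<open>G\<close>. Every game counts as a follower of itself.\<close>

inductive follower :: "game \<Rightarrow> game \<Rightarrow> bool" for G :: game where
  follower_refl: "follower G G"
| follower_left: "follower G K \<Longrightarrow> X |\<in>| opts (left K) \<Longrightarrow> follower G X"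
| follower_right: "follower G K \<Longrightarrow> X |\<in>| opts (right K) \<Longrightarrow> follower G X"

definition scoring_game :: "game \<Rightarrow> bool" where
  "scoring_game G \<longleftrightarrow> (\<forall>K. follower G K \<longrightarrow> left K \<noteq> Opts {||} \<and> right K \<noteq> Opts {||})"

definition atoms :: "game \<Rightarrow> real set" where
  "atoms G = {s. \<exists>K. follower G K \<and> (left K = Atom s \<or> right K = Atom s)}"

definition guaranteed :: "game \<Rightarrow> bool" where
  "guaranteed G \<longleftrightarrow> (\<forall>K. follower G K \<longrightarrow>
     (\<forall>l. left K = Atom l \<longrightarrow> (\<forall>s\<in>atoms K. l \<le> s)) \<and>
     (\<forall>r. right K = Atom r \<longrightarrow> (\<forall>s\<in>atoms K. s \<le> r)))"

definition GS :: "game set" where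
  "GS = {G. scoring_game G \<and> guaranteed G}"

lemma size_opts: "X |\<in>| A \<Longrightarrow> size X < Suc (\<Sum>x\<in>fset A. Suc (size x))"
  for X :: game
  using member_le_sum[of X "fset A" "\<lambda>x. Suc (size x)"] by simp

lemma size_left: "left G = Opts A \<Longrightarrow> X |\<in>| A \<Longrightarrow> size X < size G"
  using size_opts[of X A] by (cases G) simp

lemma size_right: "right G = Opts A \<Longrightarrow> X |\<in>| A \<Longrightarrow> size X < size G"
  using size_opts[of X A] by (cases G) simp

lemma fimage_fundef_cong [fundef_cong]:
  "A = B \<Longrightarrow> (\<And>x. x |\<in>| B \<Longrightarrow> f x = g x) \<Longrightarrow> f |`| A = g |`| B"
  by (rule fset.map_cong)

function game_sum :: "game \<Rightarrow> game \<Rightarrow> game" (infixl "\<oplus>" 65) where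
  "G \<oplus> H = Game
     (case left G of
        Atom a \<Rightarrow> (case left H of
            Atom b \<Rightarrow> Atom (a + b)
          | Opts B \<Rightarrow> Opts ((\<lambda>X. G \<oplus> X) |`| B))
      | Opts A \<Rightarrow> (case left H of
            Atom b \<Rightarrow> Opts ((\<lambda>X. X \<oplus> H) |`| A)
          | Opts B \<Rightarrow> Opts ((\<lambda>X. X \<oplus> H) |`| A |\<union>| (\<lambda>X. G \<oplus> X) |`| B)))
     (case right G of
        Atom a \<Rightarrow> (case right H of
            Atom b \<Rightarrow> Atom (a + b)
          | Opts B \<Rightarrow> Opts ((\<lambda>X. G \<oplus> X) |`| B))
      | Opts A \<Rightarrow> (case right H of
            Atom b \<Rightarrow> Opts ((\<lambda>X. X \<oplus> H) |`| A)
          | Opts B \<Rightarrow> Opts ((\<lambda>X. X \<oplus> H) |`| A |\<union>| (\<lambda>X. G \<oplus> X) |`| B)))"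
  by pat_completeness auto
termination
  by (relation "measure (\<lambda>(G, H). size G + size H)") (auto dest: size_left size_right)

function Ls :: "game \<Rightarrow> real" and Rs :: "game \<Rightarrow> real" where
  "Ls G = (case left G of Atom l \<Rightarrow> l | Opts A \<Rightarrow> Max (Rs ` fset A))"
| "Rs G = (case right G of Atom r \<Rightarrow> r | Opts A \<Rightarrow> Min (Ls ` fset A))"
  by pat_completeness auto
termination
  by (relation "measure (case_sum size size)") (auto dest: size_left size_right)

function conjugate :: "game \<Rightarrow> game" where
  "conjugate G = Game
     (case right G of Atom s \<Rightarrow> Atom (- s) | Opts A \<Rightarrow> Opts (conjugate |`| A))
     (case left G of Atom s \<Rightarrow> Atom (- s) | Opts A \<Rightarrow> Opts (conjugate |`| A))"
  by pat_completeness auto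
termination
  by (relation "measure size") (auto dest: size_left size_right)

text \<open>The equations of these functions are unconditional in a variable argument, hence would loop
  as rewrite rules.\<close>

declare game_sum.simps [simp del] Ls.simps [simp del] Rs.simps [simp del]
  conjugate.simps [simp del]

definition max_atom :: "game \<Rightarrow> real" where
  "max_atom G = Max {\<bar>t\<bar> | t. t \<in> atoms G}"

definition adjoint :: "real \<Rightarrow> real \<Rightarrow> game \<Rightarrow> game" where
  "adjoint r s G =
     conjugate G \<oplus> Game (Atom (- max_atom G - r - 1)) (Atom (max_atom G + s + 1))"

lemma finite_followers: "finite {K. follower G K}"
proof (induction "size G" arbitrary: G rule: less_induct)
  case less
  let ?O = "fset (opts (left G)) \<union> fset (opts (right G))"
  have "K = G \<or> (\<exists>X\<in>?O. follower X K)" if "follower G K" for K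
    using that by induction (auto intro: follower.intros)
  then have "{K. follower G K} \<subseteq> insert G (\<Union>X\<in>?O. {K. follower X K})"
    by auto
  moreover have "size X < size G" if "X \<in> ?O" for X
    using that by (cases "left G"; cases "right G") (auto dest: size_left size_right)
  then have "finite (insert G (\<Union>X\<in>?O. {K. follower X K}))"
    using less by (intro finite.insertI finite_UN_I) auto
  ultimately show ?case
    using finite_subset by blast
qed

lemma finite_atoms: "finite (atoms G)"
proof -
  have "atoms G \<subseteq> (\<Union>K\<in>{K. follower G K}. {s. left K = Atom s} \<union> {s. right K = Atom s})"
    by (auto simp: atoms_def)
  moreover have "finite {s. A = Atom s}" for A :: "game side"
    by (cases A) auto
  ultimately show ?thesis
    by (meson finite_UN_I finite_UnI finite_followers finite_subset)
qed

lemma atoms_nonempty: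
  assumes "scoring_game G"
  shows "atoms G \<noteq> {}"
proof -
  obtain K where K: "follower G K" and min: "\<And>L. follower G L \<Longrightarrow> size K \<le> size L"
    using follower_refl
    by (metis arg_min_nat_lemma)
  show ?thesis
  proof (cases "left K")
    case (Atom s)
    with K show ?thesis by (auto simp: atoms_def)
  next
    case (Opts A)
    with assms K obtain X where "X |\<in>| A"
      unfolding scoring_game_def by (metis equalsffemptyI)
    with Opts K have "follower G X" "size X < size K"
      by (auto intro: follower_left size_left)
    with min show ?thesis by fastforce
  qed
qed

end

theory Submission
  imports Defs
begin

text \<open>In \<open>K \<oplus> (conjugate K \<oplus> \<langle>\<emptyset>\<^sup>p | \<emptyset>\<^sup>q\<rangle>)\<close> the second player mirrors: a move in
  \<open>K\<close> is answered by its conjugate in \<open>conjugate K\<close> and vice versa, which leads to a position of the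
  same form. The first player, say Left, runs out of moves only when \<open>K\<close> is atomic on both sides, with
  atoms \<open>a\<close> and \<open>b\<close>; since \<open>K\<close> is guaranteed, \<open>a \<le> b\<close> and the final score \<open>a - b + p\<close> is at most \<open>p\<close>.\<close>

text \<open>Because \<open>opts\<close> of an atom is \<open>{||}\<close>, the four cases of the sum
  collapse into a single union.\<close>

lemma opts_left_game_sum:
  "opts (left (G \<oplus> H)) = (\<lambda>X. X \<oplus> H) |`| opts (left G) |\<union>| (\<lambda>X. G \<oplus> X) |`| opts (left H)"
  by (subst game_sum.simps) (auto split: side.splits)

lemma opts_right_game_sum:
  "opts (right (G \<oplus> H)) = (\<lambda>X. X \<oplus> H) |`| opts (right G) |\<union>| (\<lambda>X. G \<oplus> X) |`| opts (right H)"
  by (subst game_sum.simps) (auto split: side.splits)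

lemma left_game_sum_eq_Atom:
  "left (G \<oplus> H) = Atom c \<longleftrightarrow> (\<exists>a b. left G = Atom a \<and> left H = Atom b \<and> c = a + b)"
  by (subst game_sum.simps) (auto split: side.splits)

lemma right_game_sum_eq_Atom:
  "right (G \<oplus> H) = Atom c \<longleftrightarrow> (\<exists>a b. right G = Atom a \<and> right H = Atom b \<and> c = a + b)"
  by (subst game_sum.simps) (auto split: side.splits)

lemma left_game_sum_nonempty:
  "left G \<noteq> Opts {||} \<Longrightarrow> left H \<noteq> Opts {||} \<Longrightarrow> left (G \<oplus> H) \<noteq> Opts {||}"
  by (subst game_sum.simps) (auto split: side.splits)

lemma right_game_sum_nonempty:
  "right G \<noteq> Opts {||} \<Longrightarrow> right H \<noteq> Opts {||} \<Longrightarrow> right (G \<oplus> H) \<noteq> Opts {||}"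
  by (subst game_sum.simps) (auto split: side.splits)

lemma opts_left_conjugate: "opts (left (conjugate G)) = conjugate |`| opts (right G)"
  by (subst conjugate.simps) (auto split: side.splits)

lemma opts_right_conjugate: "opts (right (conjugate G)) = conjugate |`| opts (left G)"
  by (subst conjugate.simps) (auto split: side.splits)

lemma left_conjugate_eq_Atom: "left (conjugate G) = Atom c \<longleftrightarrow> right G = Atom (- c)"
  by (subst conjugate.simps) (auto split: side.splits)

lemma right_conjugate_eq_Atom: "right (conjugate G) = Atom c \<longleftrightarrow> left G = Atom (- c)"
  by (subst conjugate.simps) (auto split: side.splits)

lemma left_conjugate_nonempty: "right G \<noteq> Opts {||} \<Longrightarrow> left (conjugate G) \<noteq> Opts {||}"
  by (subst conjugate.simps) (auto split: side.splits)

lemma right_conjugate_nonempty: "left G \<noteq> Opts {||} \<Longrightarrow> right (conjugate G) \<noteq> Opts {||}"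
  by (subst conjugate.simps) (auto split: side.splits)

text \<open>With its dual below, this turns a single good reply into a bound on the replying
  player's stop. An element of \<open>opts\<close> already rules out an atomic side.\<close>

lemma Rs_option_le_Ls: "X |\<in>| opts (left G) \<Longrightarrow> Rs X \<le> Ls G"
  by (subst Ls.simps) (cases "left G"; auto)

lemma Rs_le_Ls_option: "X |\<in>| opts (right G) \<Longrightarrow> Rs G \<le> Ls X"
  by (subst Rs.simps) (cases "right G"; auto)

text \<open>Here every move has to be checked. The first premise excludes \<open>Max\<close> of the
  empty set, whose value is unspecified.\<close>

lemma Ls_leI:
  assumes "left G \<noteq> Opts {||}"
    and "\<And>l. left G = Atom l \<Longrightarrow> l \<le> p"
    and "\<And>X. X |\<in>| opts (left G) \<Longrightarrow> Rs X \<le> p"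
  shows "Ls G \<le> p"
  using assms by (subst Ls.simps) (cases "left G"; auto intro!: Max.boundedI)

lemma Rs_geI:
  assumes "right G \<noteq> Opts {||}"
    and "\<And>r. right G = Atom r \<Longrightarrow> q \<le> r"
    and "\<And>X. X |\<in>| opts (right G) \<Longrightarrow> q \<le> Ls X"
  shows "q \<le> Rs G"
  using assms by (subst Rs.simps) (cases "right G"; auto intro!: Min.boundedI)

lemma follower_trans: "follower H K \<Longrightarrow> follower G H \<Longrightarrow> follower G K"
  by (induction rule: follower.induct) (auto intro: follower.intros)

lemma GS_follower: "G \<in> GS \<Longrightarrow> follower G K \<Longrightarrow> K \<in> GS"
  unfolding GS_def scoring_game_def guaranteed_def by (blast intro: follower_trans)

lemma GS_nonempty:
  assumes "G \<in> GS"
  shows "left G \<noteq> Opts {||}" "right G \<noteq> Opts {||}"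
  using assms follower_refl unfolding GS_def scoring_game_def by blast+

text \<open>The guarantee enters the mirror argument here: \<open>G\<close> is its own follower, so
  \<open>b\<close> occurs in \<open>G\<close>.\<close>

lemma GS_atomic_le: "G \<in> GS \<Longrightarrow> left G = Atom a \<Longrightarrow> right G = Atom b \<Longrightarrow> a \<le> b"
  using follower_refl unfolding GS_def guaranteed_def atoms_def by blast

lemma size_opts_left: "X |\<in>| opts (left G) \<Longrightarrow> size X < size G"
  by (cases "left G") (auto dest: size_left)

lemma size_opts_right: "X |\<in>| opts (right G) \<Longrightarrow> size X < size G"
  by (cases "right G") (auto dest: size_right)

lemma stops_mirror:
  assumes "K \<in> GS"
  shows "Ls (K \<oplus> (conjugate K \<oplus> Game (Atom p) (Atom q))) \<le> p \<and>
    q \<le> Rs (K \<oplus> (conjugate K \<oplus> Game (Atom p) (Atom q)))"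
  using assms
proof (induction "size K" arbitrary: K rule: less_induct)
  case less
  let ?Z = "Game (Atom p) (Atom q)"
  \<comment> \<open>Two arguments, so that positions between a move and its mirrored answer,
    \<open>?S X K\<close> and \<open>?S K X\<close>, can be named too.\<close>
  let ?S = "\<lambda>X Y. X \<oplus> (conjugate Y \<oplus> ?Z)"
  have IH: "Ls (?S X X) \<le> p" "q \<le> Rs (?S X X)"
    if "X |\<in>| opts (left K) \<or> X |\<in>| opts (right K)" for X
  proof -
    have "size X < size K" "X \<in> GS"
      using that less.prems
      by (auto intro: size_opts_left size_opts_right GS_follower follower.intros)
    then show "Ls (?S X X) \<le> p" "q \<le> Rs (?S X X)"
      using less.hyps by auto
  qed
  note sum_simps = opts_left_game_sum opts_right_game_sum opts_left_conjugate opts_right_conjugate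
  have "Ls (?S K K) \<le> p"
  proof (rule Ls_leI)
    show "left (?S K K) \<noteq> Opts {||}"
      using GS_nonempty[OF less.prems]
      by (intro left_game_sum_nonempty left_conjugate_nonempty) auto
  next
    fix l assume "left (?S K K) = Atom l"
    then show "l \<le> p"
      using GS_atomic_le[OF less.prems]
      by (fastforce simp: left_game_sum_eq_Atom left_conjugate_eq_Atom)
  next
    fix Y assume "Y |\<in>| opts (left (?S K K))"
    \<comment> \<open>Left moves in \<open>K\<close>, or in \<open>conjugate K\<close>, whose Left
      options come from Right options of \<open>K\<close>; \<open>?Z\<close> offers no move.\<close>
    then consider X where "X |\<in>| opts (left K)" "Y = ?S X K"
      | X where "X |\<in>| opts (right K)" "Y = ?S K X"
      by (auto simp: sum_simps)
    then show "Rs Y \<le> p"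
    proof cases
      case 1
      \<comment> \<open>Right answers by moving \<open>conjugate K\<close> to
        \<open>conjugate X\<close>.\<close>
      then have "?S X X |\<in>| opts (right Y)"
        by (auto simp: sum_simps)
      with 1 show ?thesis
        using IH(1)[of X] Rs_le_Ls_option by fastforce
    next
      case 2
      \<comment> \<open>Left moved to \<open>conjugate X\<close>; Right answers by moving
        \<open>K\<close> to \<open>X\<close>.\<close>
      then have "?S X X |\<in>| opts (right Y)"
        by (auto simp: sum_simps)
      with 2 show ?thesis
        using IH(1)[of X] Rs_le_Ls_option by fastforce
    qed
  qed
  moreover have "q \<le> Rs (?S K K)"
  proof (rule Rs_geI)
    show "right (?S K K) \<noteq> Opts {||}"
      using GS_nonempty[OF less.prems]
      by (intro right_game_sum_nonempty right_conjugate_nonempty) auto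
  next
    fix l assume "right (?S K K) = Atom l"
    then show "q \<le> l"
      using GS_atomic_le[OF less.prems]
      by (fastforce simp: right_game_sum_eq_Atom right_conjugate_eq_Atom)
  next
    fix Y assume "Y |\<in>| opts (right (?S K K))"
    \<comment> \<open>The same mirroring with the players exchanged: Left now restores the symmetric
      position.\<close>
    then consider X where "X |\<in>| opts (right K)" "Y = ?S X K"
      | X where "X |\<in>| opts (left K)" "Y = ?S K X"
      by (auto simp: sum_simps)
    then show "q \<le> Ls Y"
    proof cases
      case 1
      then have "?S X X |\<in>| opts (left Y)"
        by (auto simp: sum_simps)
      with 1 show ?thesis
        using IH(2)[of X] Rs_option_le_Ls by fastforce
    next
      case 2
      then have "?S X X |\<in>| opts (left Y)"
        by (auto simp: sum_simps)
      with 2 show ?thesis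
        using IH(2)[of X] Rs_option_le_Ls by fastforce
    qed
  qed
  ultimately show ?case ..
qed

text \<open>A scoring game has an atom, so the maximum is taken over a nonempty set of absolute
  values.\<close>

lemma max_atom_nonneg:
  assumes "scoring_game G"
  shows "0 \<le> max_atom G"
proof -
  obtain t where "t \<in> atoms G"
    using atoms_nonempty[OF assms] by blast
  moreover have "finite {\<bar>t\<bar> | t. t \<in> atoms G}"
    using finite_atoms[of G] by simp
  ultimately have "\<bar>t\<bar> \<le> max_atom G"
    unfolding max_atom_def by (auto intro: Max_ge)
  then show ?thesis by linarith
qed

theorem theorem36:
  fixes G :: game and r s :: real
  assumes "G \<in> GS" and "r \<ge> 0" and "s \<ge> 0"
  shows "Ls (G \<oplus> adjoint r s G) < - r \<and> Rs (G \<oplus> adjoint r s G) > s"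
proof -
  have "0 \<le> max_atom G"
    using assms(1) max_atom_nonneg by (simp add: GS_def)
  \<comment> \<open>The atoms of the last summand of the adjoint serve as \<open>p\<close> and
    \<open>q\<close>; their offset 1 makes both inequalities strict even when
    \<open>max_atom G\<close> is 0.\<close>
  then show ?thesis
    using stops_mirror[OF assms(1), of "- max_atom G - r - 1" "max_atom G + s + 1"]
    unfolding adjoint_def by linarith
qed

end
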